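(* Suppose that $A$ and $B$ are paramonotone, and $\sigma\tau LL^*=\operatorname{Id}_Y$. Let $(z_0,k_0)\in Z\times K$, $x\in X$, and $\rho\in\mathbb{R}$. Then the following hold: (i) $Z-\rho L^*K$ is convex and closed. (ii) $P_{Z-\rho L^*K}(x)=P_Z(x+\rho L^*k_0)+P_{-\rho L^*K}(x-z_0)$. (iii) If $(Z-z_0)\perp\rho L^*K$, then $P_{Z-\rho L^*K}(x)=P_Z(x)+P_{-\rho L^*K}(x-z_0)$. (iv) If $Z\perp\rho(L^*K-L^*k_0)$, then $P_{Z-\rho L^*K}(x)=P_Z(x+\rho L^*k_0)+P_{-\rho L^*K}(x)$.
   Context: $X$ and $Y$ are real Hilbert spaces, $L\colon X\to Y$ is continuous and linear with adjoint $L^*$, $A\colon X\rightrightarrows X$ and $B\colon Y\rightrightarrows Y$ are maximally monotone set-valued operators, and $\sigma>0$, $\tau>0$ satisfy $\sigma\tau\|L\|^2\leq 1$. Inverses are in the sense of set-valued operators. Set $$Z:=\{x\in X: 0\in Ax+L^*BLx\},\qquad K:=\{y\in Y: 0\in B^{-1}y-LA^{-1}(-L^*y)\}.$$ A monotone operator $A$ is paramonotone if $(x_0,u_0),(x_1,u_1)\in\operatorname{gra}A$ and $\langle x_0-x_1,u_0-u_1\rangle=0$ imply $(x_0,u_1)\in\operatorname{gra}A$ and $(x_1,u_0)\in\operatorname{gra}A$. $P_C$ is the projection onto a nonempty closed convex set $C$; sums, differences and scalar multiples of sets are in the Minkowski sense; $C\perp D$ means $\langle c,d\rangle=0$ for all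 $c\in C$, $d\in D$. *)

theory Defs
  imports "HOL-Analysis.Analysis" "HOL-Library.Set_Algebras"
begin

text \<open>
  Real Hilbert spaces are the types of sort \<open>{real_inner, complete_space}\<close>, with no
  restriction on the dimension. Set-valued operators are functions into sets.
  The adjoint is the constant \<open>adjoint\<close> of the library; it is a Hilbert choice from all
  \<open>g\<close> with \<open>L x \<bullet> y = x \<bullet> g y\<close>, and such a \<open>g\<close> exists and is unique
  when \<open>L\<close> is bounded linear and its domain is complete.
\<close>

definition gra :: "('a \<Rightarrow> 'b set) \<Rightarrow> ('a \<times> 'b) set"
  where "gra A = {(x, u). u \<in> A x}"

definition op_inverse :: "('a \<Rightarrow> 'b set) \<Rightarrow> 'b \<Rightarrow> 'a set"
  where "op_inverse A u = {x. u \<in> A x}"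

definition monotone_op :: "('a::real_inner \<Rightarrow> 'a set) \<Rightarrow> bool"
  where "monotone_op A \<longleftrightarrow>
    (\<forall>(x, u) \<in> gra A. \<forall>(y, v) \<in> gra A. 0 \<le> (x - y) \<bullet> (u - v))"

definition maximally_monotone :: "('a::real_inner \<Rightarrow> 'a set) \<Rightarrow> bool"
  where "maximally_monotone A \<longleftrightarrow>
    monotone_op A \<and> (\<forall>A'. monotone_op A' \<and> gra A \<subseteq> gra A' \<longrightarrow> gra A' = gra A)"

definition paramonotone :: "('a::real_inner \<Rightarrow> 'a set) \<Rightarrow> bool"
  where "paramonotone A \<longleftrightarrow>
    monotone_op A \<and>
    (\<forall>x0 u0 x1 u1. (x0, u0) \<in> gra A \<and> (x1, u1) \<in> gra A \<and> (x0 - x1) \<bullet> (u0 - u1) = 0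
      \<longrightarrow> (x0, u1) \<in> gra A \<and> (x1, u0) \<in> gra A)"

text \<open>
  On sets, \<open>+\<close> is the Minkowski sum of \<open>HOL-Library.Set_Algebras\<close>, whereas
  \<open>-\<close> is set-theoretic difference. The Minkowski difference therefore needs its own
  symbol; it is the set of all differences, not the erosion of one set by the other.
\<close>

definition minkowski_diff :: "'a::ab_group_add set \<Rightarrow> 'a set \<Rightarrow> 'a set"  (infixl "\<ominus>" 65)
  where "C \<ominus> D = {c - d | c d. c \<in> C \<and> d \<in> D}"

definition primal_solutions ::
  "('a::real_inner \<Rightarrow> 'a set) \<Rightarrow> ('b::real_inner \<Rightarrow> 'b set) \<Rightarrow> ('a \<Rightarrow> 'b) \<Rightarrow> 'a set"
  where "primal_solutions A B L = {x. 0 \<in> A x + adjoint L ` B (L x)}"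

definition dual_solutions ::
  "('a::real_inner \<Rightarrow> 'a set) \<Rightarrow> ('b::real_inner \<Rightarrow> 'b set) \<Rightarrow> ('a \<Rightarrow> 'b) \<Rightarrow> 'b set"
  where "dual_solutions A B L =
    {y. 0 \<in> op_inverse B y \<ominus> L ` op_inverse A (- adjoint L y)}"

text \<open>
  The constant \<open>closest_point\<close> of the library is confined to types of class
  \<open>heine_borel\<close>, hence to finite dimension. As there, the value is meaningful
  only if the nearest point exists, e.g. for \<open>C\<close> nonempty, closed and convex.
\<close>

definition proj :: "'a::real_inner set \<Rightarrow> 'a \<Rightarrow> 'a"
  where "proj C x = (THE p. p \<in> C \<and> (\<forall>c\<in>C. dist x p \<le> dist x c))"

definition orthogonal_sets :: "'a::real_inner set \<Rightarrow> 'a set \<Rightarrow> bool"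
  where "orthogonal_sets C D \<longleftrightarrow> (\<forall>c\<in>C. \<forall>d\<in>D. c \<bullet> d = 0)"

end

theory Submission
  imports Defs
begin

text \<open>
  Pairs \<open>(x, y)\<close> with \<open>y \<in> B (L x)\<close> and \<open>- L\<^sup>* y \<in> A x\<close> are called saddle pairs below:
  \<open>Z\<close> and \<open>K\<close> are the two projections of the set of saddle pairs. For two
  such pairs, monotonicity of \<open>A\<close> bounds \<open>(x - x') \<bullet> L\<^sup>* (y - y')\<close> above by \<open>0\<close> and
  monotonicity of \<open>B\<close> bounds it below by \<open>0\<close>, so it vanishes. Paramonotonicity then permits
  exchanging \<open>y\<close> and \<open>y'\<close> in both inclusions. So every pair in \<open>Z \<times> K\<close> is a saddle
  pair. Therefore the directions of \<open>Z\<close>, that is, the differences of its points, are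
  orthogonal to the directions of \<open>L\<^sup>* K\<close>.

  The first of these facts describes \<open>Z\<close> by the single multiplier \<open>k0\<close>, as an intersection of
  preimages of values of the inverses of \<open>A\<close> and \<open>B\<close>, and \<open>K\<close> likewise by \<open>z0\<close>.
  Values of maximally monotone operators and of their inverses are closed and convex, hence so
  are \<open>Z\<close> and \<open>K\<close>. The hypothesis \<open>\<sigma> \<tau> L L\<^sup>* = Id\<close> gives \<open>L\<^sup>*\<close> a continuous left inverse, so
  \<open>L\<^sup>* K\<close> is closed too.

  The second makes the projection onto the sum split. If the directions of \<open>C\<close> and
  \<open>D\<close> are orthogonal, \<open>c0 \<in> C\<close> and \<open>d0 \<in> D\<close>, then adding the variational inequalities for
  \<open>p = P\<^sub>C (x - d0)\<close> and \<open>q = P\<^sub>D (x - c0)\<close> yields the one for \<open>p + q\<close> and \<open>x\<close>, because the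
  cross terms vanish. Every point thus has a nearest point in \<open>C + D\<close>, and this also forces
  \<open>C + D\<close> to be closed. The last two formulas hold because moving a point
  orthogonally to the directions of a set does not change its projection onto that set.

  In infinite dimension, two classical facts about Hilbert spaces come first: nearest
  points exist in nonempty closed convex sets, and bounded linear functionals are inner products, so that
  \<open>adjoint L\<close> is indeed an adjoint of \<open>L\<close>.
\<close>

section \<open>Projections in Hilbert spaces\<close>

text \<open>
  In a minimizing sequence, the midpoint of two members is no closer to \<open>x\<close> than the
  infimum, so the parallelogram law makes the sequence Cauchy.
\<close>

lemma nearest_point_exists:
  fixes C :: "'a::{real_inner, complete_space} set"
  assumes "convex C" and "closed C" and "C \<noteq> {}"
  shows "\<exists>p\<in>C. \<forall>c\<in>C. dist x p \<le> dist x c"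
proof -
  define \<delta> where "\<delta> = (INF c\<in>C. (norm (x - c))\<^sup>2)"
  have lower: "\<delta> \<le> (norm (x - c))\<^sup>2" if "c \<in> C" for c
    unfolding \<delta>_def by (intro cINF_lower bdd_belowI2[where m = 0] that) simp
  have "\<exists>c\<in>C. (norm (x - c))\<^sup>2 < \<delta> + 1 / (real n + 1)" for n
    using cInf_lessD[of "(\<lambda>c. (norm (x - c))\<^sup>2) ` C" "\<delta> + 1 / (real n + 1)"] \<open>C \<noteq> {}\<close>
    unfolding \<delta>_def by force
  then obtain s where s: "\<And>n. s n \<in> C" "\<And>n. (norm (x - s n))\<^sup>2 < \<delta> + 1 / (real n + 1)"
    by metis
  have gap: "(norm (s m - s n))\<^sup>2 \<le> 2 * (1 / (real m + 1)) + 2 * (1 / (real n + 1))" for m n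
  proof -
    define mid where "mid = (1/2) *\<^sub>R s m + (1/2) *\<^sub>R s n"
    have "mid \<in> C"
      unfolding mid_def using \<open>convex C\<close> s(1) by (intro convexD) auto
    moreover have "(norm (s m - s n))\<^sup>2 + 4 * (norm (x - mid))\<^sup>2
        = 2 * (norm (x - s m))\<^sup>2 + 2 * (norm (x - s n))\<^sup>2"
      unfolding mid_def power2_norm_eq_inner
      by (simp add: inner_commute algebra_simps)
    ultimately show ?thesis
      using lower[of mid] s(2)[of m] s(2)[of n] by linarith
  qed
  have "Cauchy s"
  proof (rule CauchyI)
    fix e :: real assume "0 < e"
    then obtain N where N: "inverse (real (Suc N)) < e\<^sup>2 / 4"
      using reals_Archimedean[of "e\<^sup>2 / 4"] by auto
    have "norm (s m - s n) < e" if "N \<le> m" "N \<le> n" for m n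
    proof (rule power2_less_imp_less)
      have "1 / (real k + 1) \<le> inverse (real (Suc N))" if "N \<le> k" for k
        using that by (simp add: field_simps)
      from this[OF \<open>N \<le> m\<close>] this[OF \<open>N \<le> n\<close>] gap[of m n] N
      show "(norm (s m - s n))\<^sup>2 < e\<^sup>2" by simp
    qed (use \<open>0 < e\<close> in simp)
    then show "\<exists>N. \<forall>m\<ge>N. \<forall>n\<ge>N. norm (s m - s n) < e" by blast
  qed
  then obtain p where p: "s \<longlonglongrightarrow> p"
    by (auto simp: Cauchy_convergent_iff convergent_def)
  then have "p \<in> C"
    using closed_sequentially[OF \<open>closed C\<close>] s(1) by blast
  have "(norm (x - p))\<^sup>2 \<le> \<delta> + 0"
  proof (rule LIMSEQ_le)
    show "(\<lambda>n. (norm (x - s n))\<^sup>2) \<longlonglongrightarrow> (norm (x - p))\<^sup>2"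
      by (intro tendsto_intros p)
    show "(\<lambda>n. \<delta> + 1 / (real n + 1)) \<longlonglongrightarrow> \<delta> + 0"
      using LIMSEQ_inverse_real_of_nat
      by (intro tendsto_add tendsto_const) (simp add: inverse_eq_divide add.commute)
  qed (use s(2) less_imp_le in blast)
  then have "(norm (x - p))\<^sup>2 \<le> (norm (x - c))\<^sup>2" if "c \<in> C" for c
    using lower[OF that] by linarith
  then have "dist x p \<le> dist x c" if "c \<in> C" for c
    unfolding dist_norm by (rule power2_le_imp_le) (simp_all add: that)
  with \<open>p \<in> C\<close> show ?thesis by blast
qed

lemma obtuse_angle_imp_nearest:
  fixes x :: "'a::real_inner"
  assumes "(x - p) \<bullet> (c - p) \<le> 0"
  shows "(dist x p)\<^sup>2 + (dist p c)\<^sup>2 \<le> (dist x c)\<^sup>2"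
  using assms unfolding dist_norm power2_norm_eq_inner
  by (simp add: inner_commute algebra_simps)

lemma proj_eqI:
  fixes x :: "'a::real_inner"
  assumes "p \<in> C" and obtuse: "\<And>c. c \<in> C \<Longrightarrow> (x - p) \<bullet> (c - p) \<le> 0"
  shows "proj C x = p"
  unfolding proj_def
proof (rule the_equality)
  have "(dist x p)\<^sup>2 \<le> (dist x c)\<^sup>2" if "c \<in> C" for c
    using obtuse_angle_imp_nearest[OF obtuse[OF that]] zero_le_power2[of "dist p c"] by linarith
  then have "dist x p \<le> dist x c" if "c \<in> C" for c
    using that by (blast intro: power2_le_imp_le[OF _ zero_le_dist])
  with \<open>p \<in> C\<close> show "p \<in> C \<and> (\<forall>c\<in>C. dist x p \<le> dist x c)" by blast
next
  fix q assume q: "q \<in> C \<and> (\<forall>c\<in>C. dist x q \<le> dist x c)"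
  then have "(dist x q)\<^sup>2 \<le> (dist x p)\<^sup>2"
    using \<open>p \<in> C\<close> by (simp add: power_mono)
  moreover have "(dist x p)\<^sup>2 + (dist p q)\<^sup>2 \<le> (dist x q)\<^sup>2"
    using q by (intro obtuse_angle_imp_nearest obtuse) blast
  ultimately have "(dist p q)\<^sup>2 \<le> 0" by linarith
  then show "q = p" by simp
qed

lemma proj_nearest:
  fixes C :: "'a::{real_inner, complete_space} set"
  assumes "convex C" and "closed C" and "C \<noteq> {}"
  shows proj_in: "proj C x \<in> C"
    and proj_obtuse: "c \<in> C \<Longrightarrow> (x - proj C x) \<bullet> (c - proj C x) \<le> 0"
proof -
  obtain p where p: "p \<in> C" "\<forall>c\<in>C. dist x p \<le> dist x c"
    using nearest_point_exists[OF assms] by blast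
  then have obtuse: "(x - p) \<bullet> (c - p) \<le> 0" if "c \<in> C" for c
    using any_closest_point_dot[OF assms(1,2)] that by blast
  with p(1) have eq: "proj C x = p" by (intro proj_eqI)
  show "proj C x \<in> C"
    unfolding eq by (rule p(1))
  show "(x - proj C x) \<bullet> (c - proj C x) \<le> 0" if "c \<in> C"
    unfolding eq using that by (rule obtuse)
qed

lemma proj_shift_orthogonal:
  fixes C :: "'a::{real_inner, complete_space} set"
  assumes C: "convex C" "closed C" "C \<noteq> {}"
    and orth: "\<And>c c'. c \<in> C \<Longrightarrow> c' \<in> C \<Longrightarrow> v \<bullet> (c - c') = 0"
  shows "proj C (x + v) = proj C x"
proof (rule proj_eqI)
  show "proj C x \<in> C" by (rule proj_in[OF C])
  fix c assume "c \<in> C"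
  then have "v \<bullet> (c - proj C x) = 0" by (intro orth proj_in[OF C])
  moreover have "(x + v - proj C x) \<bullet> (c - proj C x)
      = (x - proj C x) \<bullet> (c - proj C x) + v \<bullet> (c - proj C x)"
    by (simp add: inner_add_left inner_diff_left)
  ultimately show "(x + v - proj C x) \<bullet> (c - proj C x) \<le> 0"
    using proj_obtuse[OF C \<open>c \<in> C\<close>, of x] by linarith
qed

text \<open>
  A point of the closure has distance \<open>0\<close> from the set, hence coincides with its nearest point.
\<close>

lemma closed_if_nearest_points:
  fixes S :: "'a::real_inner set"
  assumes "\<And>x. \<exists>p\<in>S. \<forall>s\<in>S. (x - p) \<bullet> (s - p) \<le> 0"
  shows "closed S"
proof -
  have "x \<in> S" if "x \<in> closure S" for x
  proof -
    obtain p where p: "p \<in> S" "\<forall>s\<in>S. (x - p) \<bullet> (s - p) \<le> 0"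
      using assms[of x] by auto
    have "dist x p \<le> e" if "0 < e" for e
    proof -
      obtain s where "s \<in> S" "dist s x < e"
        using \<open>x \<in> closure S\<close> \<open>0 < e\<close> unfolding closure_approachable by blast
      moreover have "(dist x p)\<^sup>2 \<le> (dist x s)\<^sup>2"
        using obtuse_angle_imp_nearest[OF bspec[OF p(2) \<open>s \<in> S\<close>]]
          zero_le_power2[of "dist p s"] by linarith
      ultimately show ?thesis
        using power2_le_imp_le[of "dist x p" "dist x s"] by (simp add: dist_commute)
    qed
    then have "dist x p \<le> 0" by (rule field_le_epsilon) simp
    with p(1) show "x \<in> S" by simp
  qed
  then show ?thesis by (metis closure_subset_eq subsetI)
qed

section \<open>Sums of sets with orthogonal directions\<close>

text \<open>
  The projection formula depends on base points \<open>c0\<close> and \<open>d0\<close> because only differences within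
  the two sets are orthogonal: \<open>C\<close> and \<open>D\<close> may be shifted away from orthogonal subspaces.
\<close>

locale orthogonal_summands =
  fixes C D :: "'a::{real_inner, complete_space} set" and c0 d0 :: 'a
  assumes C: "convex C" "closed C" "c0 \<in> C"
    and D: "convex D" "closed D" "d0 \<in> D"
    and orth: "\<And>c c' d d'. \<lbrakk>c \<in> C; c' \<in> C; d \<in> D; d' \<in> D\<rbrakk> \<Longrightarrow> (c - c') \<bullet> (d - d') = 0"
begin

lemma nonempty: "C \<noteq> {}" "D \<noteq> {}"
  using C(3) D(3) by auto

lemma sum_in: "proj C (x - d0) + proj D (x - c0) \<in> C + D"
  using proj_in[OF C(1,2) nonempty(1)] proj_in[OF D(1,2) nonempty(2)]
  by (intro set_plus_intro)

lemma sum_obtuse: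
  fixes x :: 'a
  assumes "s \<in> C + D"
  defines "p \<equiv> proj C (x - d0)" and "q \<equiv> proj D (x - c0)"
  shows "(x - (p + q)) \<bullet> (s - (p + q)) \<le> 0"
proof -
  obtain c d where s: "s = c + d" "c \<in> C" "d \<in> D"
    using assms(1) by (auto elim: set_plus_elim)
  have pq: "p \<in> C" "q \<in> D"
    unfolding p_def q_def
    using proj_in[OF C(1,2) nonempty(1)] proj_in[OF D(1,2) nonempty(2)] by auto
  have "(x - d0 - p) \<bullet> (c - p) \<le> 0" "(x - c0 - q) \<bullet> (d - q) \<le> 0"
    unfolding p_def q_def using s
    by (auto intro: proj_obtuse C D nonempty)
  \<comment> \<open>These are the cross terms: \<open>x - (p + q)\<close> is \<open>(x - d0 - p) - (q - d0)\<close>, to be tested against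
    \<open>c - p\<close>, and also \<open>(x - c0 - q) - (p - c0)\<close>, to be tested against \<open>d - q\<close>.\<close>
  moreover have "(c - p) \<bullet> (q - d0) = 0" "(p - c0) \<bullet> (d - q) = 0"
    using orth s pq C(3) D(3) by auto
  moreover have "(x - (p + q)) \<bullet> (s - (p + q))
      = (x - d0 - p) \<bullet> (c - p) - (c - p) \<bullet> (q - d0)
        + (x - c0 - q) \<bullet> (d - q) - (p - c0) \<bullet> (d - q)"
    unfolding s(1) by (simp add: inner_commute algebra_simps)
  ultimately show ?thesis by simp
qed

lemma proj_sum: "proj (C + D) x = proj C (x - d0) + proj D (x - c0)"
  by (rule proj_eqI[OF sum_in sum_obtuse])

lemma closed_sum: "closed (C + D)"
proof (rule closed_if_nearest_points)
  show "\<exists>p\<in>C + D. \<forall>s\<in>C + D. (x - p) \<bullet> (s - p) \<le> 0" for x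
    using sum_in[of x] sum_obtuse[of _ x] by blast
qed

end

section \<open>Riesz representation and adjoints\<close>

text \<open>
  Take a vector \<open>w\<close> normal to the kernel of \<open>f\<close>, as the residual of a projection onto it.
  Modulo the kernel every \<open>x\<close> is a multiple of \<open>w\<close>, so \<open>f\<close> is a multiple of the inner product
  with \<open>w\<close>.
\<close>

lemma riesz_representation:
  fixes f :: "'a::{real_inner, complete_space} \<Rightarrow> real"
  assumes "bounded_linear f"
  shows "\<exists>z. \<forall>x. f x = x \<bullet> z"
proof (cases "\<forall>x. f x = 0")
  case True
  then show ?thesis by (intro exI[of _ 0]) simp
next
  case False
  then obtain u where u: "f u \<noteq> 0" by blast
  interpret bounded_linear f by fact
  define N where "N = {x. f x = 0}"
  have "subspace N"
    unfolding N_def by (auto simp: subspace_def add scaleR zero)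
  then have N: "convex N" "N \<noteq> {}"
    using subspace_imp_convex subspace_0 by blast+
  have "closed N"
    unfolding N_def by (intro closed_Collect_eq continuous_on continuous_on_id continuous_on_const)
  define p where "p = proj N u"
  define w where "w = u - p"
  have "p \<in> N" unfolding p_def by (intro proj_in N \<open>closed N\<close>)
  then have fw: "f w \<noteq> 0"
    using u unfolding w_def N_def by (simp add: diff)
  \<comment> \<open>On a subspace the variational inequality holds for \<open>n\<close> and \<open>- n\<close>, hence with equality.\<close>
  have half: "w \<bullet> n \<le> 0" if "n \<in> N" for n
    using proj_obtuse[OF N(1) \<open>closed N\<close> N(2), of "p + n" u] that \<open>p \<in> N\<close> \<open>subspace N\<close>
    by (simp add: w_def p_def subspace_add)
  have perp: "w \<bullet> n = 0" if "n \<in> N" for n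
    using half[OF that] half[of "- n"] that \<open>subspace N\<close> by (simp add: subspace_neg)
  have "w \<bullet> w \<noteq> 0" using fw zero by auto
  have "f x = x \<bullet> ((f w / (w \<bullet> w)) *\<^sub>R w)" for x
  proof -
    have "x - (f x / f w) *\<^sub>R w \<in> N"
      using fw unfolding N_def by (simp add: diff scaleR)
    from perp[OF this] have "x \<bullet> w = (f x / f w) * (w \<bullet> w)"
      by (simp add: inner_diff_right inner_commute)
    then show ?thesis using fw \<open>w \<bullet> w \<noteq> 0\<close> by simp
  qed
  then show ?thesis by blast
qed

lemma adjoint_inner:
  fixes L :: "'a::{real_inner, complete_space} \<Rightarrow> 'b::real_inner"
  assumes "bounded_linear L"
  shows "L x \<bullet> y = x \<bullet> adjoint L y"
proof -
  have "\<exists>z. \<forall>x. L x \<bullet> y = x \<bullet> z" for y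
    by (rule riesz_representation)
      (rule bounded_linear_compose[OF bounded_linear_inner_left assms])
  then have "\<exists>g. \<forall>x y. L x \<bullet> y = x \<bullet> g y" by metis
  from someI_ex[OF this] show ?thesis unfolding adjoint_def by blast
qed

lemma bounded_linear_adjoint:
  fixes L :: "'a::{real_inner, complete_space} \<Rightarrow> 'b::real_inner"
  assumes "bounded_linear L"
  shows "bounded_linear (adjoint L)"
proof (rule bounded_linear_intro)
  note adj = adjoint_inner[OF assms, symmetric]
  show "adjoint L (y + y') = adjoint L y + adjoint L y'" for y y'
    by (subst vector_eq_ldot[symmetric]) (simp add: adj inner_add_right)
  show "adjoint L (r *\<^sub>R y) = r *\<^sub>R adjoint L y" for r y
    by (subst vector_eq_ldot[symmetric]) (simp add: adj)
  show "norm (adjoint L y) \<le> norm y * onorm L" for y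
  proof (cases "adjoint L y = 0")
    case False
    have "(norm (adjoint L y))\<^sup>2 = L (adjoint L y) \<bullet> y"
      by (simp add: power2_norm_eq_inner adj)
    also have "\<dots> \<le> norm (L (adjoint L y)) * norm y"
      by (rule norm_cauchy_schwarz)
    also have "\<dots> \<le> onorm L * norm (adjoint L y) * norm y"
      by (intro mult_right_mono onorm assms) simp
    finally show ?thesis using False by (simp add: power2_eq_square field_simps)
  qed (simp add: onorm_pos_le assms)
qed

section \<open>Values of maximally monotone operators\<close>

lemma monotone_opD:
  "\<lbrakk>monotone_op A; u \<in> A x; v \<in> A y\<rbrakk> \<Longrightarrow> 0 \<le> (x - y) \<bullet> (u - v)"
  unfolding monotone_op_def gra_def by blast

text \<open>
  If all the inequalities hold, adjoining \<open>(x, u)\<close> to the graph keeps it monotone, so by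
  maximality the pair was there already. This turns membership into a family of inequalities, each of them affine in \<open>u\<close> for fixed \<open>x\<close>
  and affine in \<open>x\<close> for fixed \<open>u\<close>.
\<close>

lemma maximally_monotone_mem_iff:
  assumes "maximally_monotone A"
  shows "u \<in> A x \<longleftrightarrow> (\<forall>(y, v) \<in> gra A. 0 \<le> (x - y) \<bullet> (u - v))"
proof
  assume "u \<in> A x"
  then show "\<forall>(y, v) \<in> gra A. 0 \<le> (x - y) \<bullet> (u - v)"
    using assms monotone_opD unfolding maximally_monotone_def gra_def by fastforce
next
  assume *: "\<forall>(y, v) \<in> gra A. 0 \<le> (x - y) \<bullet> (u - v)"
  define A' where "A' = A(x := insert u (A x))"
  have gra': "gra A' = insert (x, u) (gra A)"
    unfolding A'_def gra_def by (auto split: if_splits)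
  have mono: "\<forall>(y, v) \<in> gra A. \<forall>(y', v') \<in> gra A. 0 \<le> (y - y') \<bullet> (v - v')"
    using assms unfolding maximally_monotone_def monotone_op_def by blast
  have "0 \<le> (y - x) \<bullet> (v - u)" if "(y, v) \<in> gra A" for y v
  proof -
    have "(y - x) \<bullet> (v - u) = (x - y) \<bullet> (u - v)"
      by (simp add: inner_diff)
    with * that show ?thesis by auto
  qed
  with * mono have "monotone_op A'"
    unfolding monotone_op_def gra' by auto
  then have "gra A' = gra A"
    using assms gra' unfolding maximally_monotone_def by blast
  then have "(x, u) \<in> gra A" using gra' by blast
  then show "u \<in> A x" by (simp add: gra_def)
qed

lemma maximally_monotone_value_eq:
  assumes "maximally_monotone A"
  shows "A x = (\<Inter>(y, v) \<in> gra A. {u. (x - y) \<bullet> v \<le> (x - y) \<bullet> u})"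
  using maximally_monotone_mem_iff[OF assms] by (auto simp: inner_diff_right)

lemma maximally_monotone_inverse_value_eq:
  assumes "maximally_monotone A"
  shows "op_inverse A u = (\<Inter>(y, v) \<in> gra A. {x. (u - v) \<bullet> y \<le> (u - v) \<bullet> x})"
  using maximally_monotone_mem_iff[OF assms]
  by (auto simp: op_inverse_def inner_diff_left inner_diff_right inner_commute)

lemma maximally_monotone_value:
  assumes "maximally_monotone A"
  shows "convex (A x)" and "closed (A x)"
  unfolding maximally_monotone_value_eq[OF assms, of x]
  by (auto intro!: convex_INT closed_INT convex_halfspace_ge[simplified] closed_halfspace_ge[simplified])

lemma maximally_monotone_inverse_value:
  assumes "maximally_monotone A"
  shows "convex (op_inverse A u)" and "closed (op_inverse A u)"
  unfolding maximally_monotone_inverse_value_eq[OF assms, of u]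
  by (auto intro!: convex_INT closed_INT convex_halfspace_ge[simplified] closed_halfspace_ge[simplified])

section \<open>Saddle pairs\<close>

definition saddle_pair ::
  "('a::real_inner \<Rightarrow> 'a set) \<Rightarrow> ('b::real_inner \<Rightarrow> 'b set) \<Rightarrow> ('a \<Rightarrow> 'b) \<Rightarrow> 'a \<Rightarrow> 'b \<Rightarrow> bool"
  where "saddle_pair A B L x y \<longleftrightarrow> - adjoint L y \<in> A x \<and> y \<in> B (L x)"

lemma primal_solutions_eq: "primal_solutions A B L = {x. \<exists>y. saddle_pair A B L x y}"
  unfolding primal_solutions_def saddle_pair_def set_plus_def
  by (auto simp: eq_neg_iff_add_eq_0[symmetric])

lemma dual_solutions_eq: "dual_solutions A B L = {y. \<exists>x. saddle_pair A B L x y}"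
  unfolding dual_solutions_def saddle_pair_def minkowski_diff_def op_inverse_def
  by auto

text \<open>
  The two monotonicity inequalities for a pair of saddle pairs bound the same number from
  opposite sides.
\<close>

lemma saddle_pairs_orthogonal:
  fixes L :: "'a::{real_inner, complete_space} \<Rightarrow> 'b::real_inner"
  assumes L: "bounded_linear L" and "monotone_op A" and "monotone_op B"
    and "saddle_pair A B L x y" and "saddle_pair A B L x' y'"
  shows "(x - x') \<bullet> (adjoint L y - adjoint L y') = 0"
    and "(L x - L x') \<bullet> (y - y') = 0"
proof -
  have "0 \<le> (x - x') \<bullet> (- adjoint L y - - adjoint L y')"
    using assms unfolding saddle_pair_def by (blast intro: monotone_opD)
  then have "(x - x') \<bullet> (adjoint L y - adjoint L y') \<le> 0"
    by (simp add: inner_diff)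
  moreover have "0 \<le> (L x - L x') \<bullet> (y - y')"
    using assms unfolding saddle_pair_def by (blast intro: monotone_opD)
  moreover have "(L x - L x') \<bullet> (y - y') = (x - x') \<bullet> (adjoint L y - adjoint L y')"
    by (simp add: inner_diff adjoint_inner[OF L])
  ultimately show "(x - x') \<bullet> (adjoint L y - adjoint L y') = 0"
    and "(L x - L x') \<bullet> (y - y') = 0" by auto
qed

lemma paramonotoneD:
  assumes "paramonotone A" and "u \<in> A x" and "v \<in> A y" and "(x - y) \<bullet> (u - v) = 0"
  shows "v \<in> A x"
  using assms unfolding paramonotone_def gra_def by blast

text \<open>
  A point of \<open>Z\<close> and a point of \<open>K\<close> come from two saddle pairs. These attain equality in both
  monotonicity inequalities, which is what paramonotonicity needs to exchange their second
  components.
\<close>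

lemma saddle_pair_rectangle:
  fixes L :: "'a::{real_inner, complete_space} \<Rightarrow> 'b::real_inner"
  assumes L: "bounded_linear L" and A: "paramonotone A" and B: "paramonotone B"
    and x: "x \<in> primal_solutions A B L" and y: "y \<in> dual_solutions A B L"
  shows "saddle_pair A B L x y"
proof -
  obtain y' x' where s: "saddle_pair A B L x y'" "saddle_pair A B L x' y"
    using x y unfolding primal_solutions_eq dual_solutions_eq by blast
  have "monotone_op A" "monotone_op B"
    using A B unfolding paramonotone_def by auto
  note orth = saddle_pairs_orthogonal[OF L this s]
  have "(x - x') \<bullet> (- adjoint L y' - - adjoint L y) = 0"
    using orth(1) by (simp add: inner_diff)
  with orth(2) s show ?thesis
    unfolding saddle_pair_def using paramonotoneD[OF A] paramonotoneD[OF B] by blast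
qed

text \<open>
  By definition the solution set is a union over all multipliers; the previous lemma replaces it
  by the condition for one fixed multiplier, whose convexity and closedness are inherited from
  \<open>A\<close> and \<open>B\<close>. The dual case fixes a primal solution instead.
\<close>

lemma primal_solutions_convex_closed:
  fixes L :: "'a::{real_inner, complete_space} \<Rightarrow> 'b::real_inner"
  assumes L: "bounded_linear L" and max: "maximally_monotone A" "maximally_monotone B"
    and para: "paramonotone A" "paramonotone B" and "k \<in> dual_solutions A B L"
  shows "convex (primal_solutions A B L)" and "closed (primal_solutions A B L)"
proof -
  have mem: "x \<in> primal_solutions A B L \<longleftrightarrow> saddle_pair A B L x k" for x
    using saddle_pair_rectangle[OF L para _ \<open>k \<in> dual_solutions A B L\<close>, of x]
    by (auto simp: primal_solutions_eq)
  have eq: "primal_solutions A B L = op_inverse A (- adjoint L k) \<inter> L -` op_inverse B k"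
    using mem unfolding saddle_pair_def op_inverse_def by auto
  show "convex (primal_solutions A B L)" unfolding eq
    using max L
    by (intro convex_Int maximally_monotone_inverse_value convex_linear_vimage
        bounded_linear.linear)
  show "closed (primal_solutions A B L)" unfolding eq
    using max L
    by (intro closed_Int maximally_monotone_inverse_value closed_vimage
        linear_continuous_on)
qed

lemma dual_solutions_convex_closed:
  fixes L :: "'a::{real_inner, complete_space} \<Rightarrow> 'b::real_inner"
  assumes L: "bounded_linear L" and max: "maximally_monotone A" "maximally_monotone B"
    and para: "paramonotone A" "paramonotone B" and "z \<in> primal_solutions A B L"
  shows "convex (dual_solutions A B L)" and "closed (dual_solutions A B L)"
proof -
  have mem: "y \<in> dual_solutions A B L \<longleftrightarrow> saddle_pair A B L z y" for y
    using saddle_pair_rectangle[OF L para \<open>z \<in> primal_solutions A B L\<close>, of y]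
    by (auto simp: dual_solutions_eq)
  have eq: "dual_solutions A B L = (\<lambda>y. - adjoint L y) -` A z \<inter> B (L z)"
    using mem unfolding saddle_pair_def by auto
  have bl: "bounded_linear (\<lambda>y. - adjoint L y)"
    by (intro bounded_linear_minus bounded_linear_adjoint L)
  show "convex (dual_solutions A B L)" unfolding eq
    using max bl
    by (intro convex_Int maximally_monotone_value convex_linear_vimage bounded_linear.linear)
  show "closed (dual_solutions A B L)" unfolding eq
    using max bl
    by (intro closed_Int maximally_monotone_value closed_vimage linear_continuous_on)
qed

text \<open>
  With a left inverse \<open>g\<close> of \<open>f\<close>, a point \<open>v\<close> lies in \<open>f ` K\<close> iff \<open>f (g v) = v\<close> and \<open>g v \<in> K\<close>;
  both are closed conditions.
\<close>

lemma closed_image_left_inverse: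
  fixes f :: "'b::t2_space \<Rightarrow> 'a::t2_space"
  assumes "continuous_on UNIV f" and "continuous_on UNIV g"
    and left_inverse: "\<And>y. g (f y) = y" and "closed K"
  shows "closed (f ` K)"
proof -
  have "f ` K = {v. f (g v) = v} \<inter> g -` K"
    using left_inverse by (auto simp: image_iff) metis
  moreover have "closed {v. f (g v) = v}"
    using assms(1,2)
    by (intro closed_Collect_eq continuous_on_id) (metis continuous_on_compose2 subset_UNIV)
  moreover have "closed (g -` K)"
    by (intro closed_vimage assms)
  ultimately show ?thesis by (metis closed_Int)
qed

lemma minkowski_diff_scaleR_image:
  "C \<ominus> (*\<^sub>R) \<rho> ` S = C + (*\<^sub>R) (- \<rho>) ` (S :: 'a::real_vector set)"
  unfolding minkowski_diff_def set_plus_def by force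

section \<open>Projection onto the primal solutions minus the dual image\<close>

theorem corollary8p4:
  fixes L :: "'a::{real_inner, complete_space} \<Rightarrow> 'b::{real_inner, complete_space}"
    and A :: "'a \<Rightarrow> 'a set" and B :: "'b \<Rightarrow> 'b set"
    and \<sigma> \<tau> \<rho> :: real
    and Z :: "'a set" and K :: "'b set"
    and z0 x :: 'a and k0 :: 'b
  assumes "bounded_linear L"
    and "maximally_monotone A" and "maximally_monotone B"
    and "\<sigma> > 0" and "\<tau> > 0" and "\<sigma> * \<tau> * (onorm L)\<^sup>2 \<le> 1"
    and "Z = primal_solutions A B L" and "K = dual_solutions A B L"
    and "paramonotone A" and "paramonotone B"
    and "(\<lambda>y. (\<sigma> * \<tau>) *\<^sub>R L (adjoint L y)) = id"
    and "(z0, k0) \<in> Z \<times> K"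
  shows "(convex (Z \<ominus> (*\<^sub>R) \<rho> ` adjoint L ` K) \<and> closed (Z \<ominus> (*\<^sub>R) \<rho> ` adjoint L ` K))
    \<and> proj (Z \<ominus> (*\<^sub>R) \<rho> ` adjoint L ` K) x
        = proj Z (x + \<rho> *\<^sub>R adjoint L k0) + proj ((*\<^sub>R) (- \<rho>) ` adjoint L ` K) (x - z0)
    \<and> (orthogonal_sets (Z \<ominus> {z0}) ((*\<^sub>R) \<rho> ` adjoint L ` K) \<longrightarrow>
        proj (Z \<ominus> (*\<^sub>R) \<rho> ` adjoint L ` K) x
          = proj Z x + proj ((*\<^sub>R) (- \<rho>) ` adjoint L ` K) (x - z0))
    \<and> (orthogonal_sets Z ((*\<^sub>R) \<rho> ` (adjoint L ` K \<ominus> {adjoint L k0})) \<longrightarrow>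
        proj (Z \<ominus> (*\<^sub>R) \<rho> ` adjoint L ` K) x
          = proj Z (x + \<rho> *\<^sub>R adjoint L k0) + proj ((*\<^sub>R) (- \<rho>) ` adjoint L ` K) x)"
proof -
  note L = assms(1) and max = assms(2,3) and para = assms(9,10)
  have z0: "z0 \<in> Z" and k0: "k0 \<in> K" using assms(12) by auto
  note Z = primal_solutions_convex_closed[OF L max para k0[unfolded assms(8)],
      folded assms(7)]
  note K = dual_solutions_convex_closed[OF L max para z0[unfolded assms(7)],
      folded assms(8)]
  have adj: "bounded_linear (adjoint L)" by (rule bounded_linear_adjoint[OF L])
  have mono: "monotone_op A" "monotone_op B"
    using para unfolding paramonotone_def by auto
  have orth: "(c - c') \<bullet> (adjoint L k - adjoint L k') = 0"
    if "c \<in> Z" "c' \<in> Z" "k \<in> K" "k' \<in> K" for c c' k k'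
    using that unfolding assms(7,8)
    by (intro saddle_pairs_orthogonal(1)[OF L mono] saddle_pair_rectangle[OF L para])
  define D where "D = (*\<^sub>R) (- \<rho>) ` adjoint L ` K"
  have sum: "Z \<ominus> (*\<^sub>R) \<rho> ` adjoint L ` K = Z + D"
    unfolding D_def by (rule minkowski_diff_scaleR_image)
  have "closed (adjoint L ` K)"
  proof (rule closed_image_left_inverse[where g = "\<lambda>x. (\<sigma> * \<tau>) *\<^sub>R L x"])
    show "(\<sigma> * \<tau>) *\<^sub>R L (adjoint L y) = y" for y
      using fun_cong[OF assms(11), of y] by simp
  qed (use L adj K in \<open>auto intro: continuous_intros linear_continuous_on\<close>)
  then have closed_D: "closed D"
    unfolding D_def by (rule closed_scaling)
  have convex_D: "convex D"
    unfolding D_def using K(1) adj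
    by (intro convex_scaling convex_linear_image bounded_linear.linear)
  define d0 where "d0 = - \<rho> *\<^sub>R adjoint L k0"
  have d0: "d0 \<in> D" unfolding D_def d0_def using k0 by blast
  have dirs: "(c - c') \<bullet> (d - d') = 0" if "c \<in> Z" "c' \<in> Z" "d \<in> D" "d' \<in> D" for c c' d d'
  proof -
    obtain k k' where k: "k \<in> K" "k' \<in> K"
      "d = (- \<rho>) *\<^sub>R adjoint L k" "d' = (- \<rho>) *\<^sub>R adjoint L k'"
      using \<open>d \<in> D\<close> \<open>d' \<in> D\<close> unfolding D_def by blast
    then have "d - d' = (- \<rho>) *\<^sub>R (adjoint L k - adjoint L k')"
      by (simp add: algebra_simps)
    then show ?thesis using orth[OF that(1,2) k(1,2)] by simp
  qed
  interpret orthogonal_summands Z D z0 d0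
    by unfold_locales (fact Z z0 convex_D closed_D d0 dirs)+
  have convex: "convex (Z + D)" by (intro convex_set_plus Z convex_D)
  have formula: "proj (Z + D) x = proj Z (x + \<rho> *\<^sub>R adjoint L k0) + proj D (x - z0)"
    using proj_sum[of x] by (simp add: d0_def)
  have primal_shift: "proj Z (x + \<rho> *\<^sub>R adjoint L k0) = proj Z x"
    if *: "orthogonal_sets (Z \<ominus> {z0}) ((*\<^sub>R) \<rho> ` adjoint L ` K)"
  proof (rule proj_shift_orthogonal[OF Z nonempty(1)])
    fix c c' assume "c \<in> Z" "c' \<in> Z"
    then have "(c - z0) \<bullet> (\<rho> *\<^sub>R adjoint L k0) = 0" "(c' - z0) \<bullet> (\<rho> *\<^sub>R adjoint L k0) = 0"
      using * k0 unfolding orthogonal_sets_def minkowski_diff_def by blast+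
    then show "(\<rho> *\<^sub>R adjoint L k0) \<bullet> (c - c') = 0"
      by (simp add: inner_diff inner_commute) argo
  qed
  \<comment> \<open>The hypothesis speaks of differences with \<open>L\<^sup>* k0\<close>; two of them give all directions of \<open>D\<close>.\<close>
  have dual_shift: "proj D (x - z0) = proj D x"
    if *: "orthogonal_sets Z ((*\<^sub>R) \<rho> ` (adjoint L ` K \<ominus> {adjoint L k0}))"
  proof -
    have to_d0: "z0 \<bullet> (d - d0) = 0" if "d \<in> D" for d
    proof -
      obtain k where k: "k \<in> K" "d = (- \<rho>) *\<^sub>R adjoint L k"
        using \<open>d \<in> D\<close> unfolding D_def by blast
      then have "z0 \<bullet> (\<rho> *\<^sub>R (adjoint L k - adjoint L k0)) = 0"
        using * z0 unfolding orthogonal_sets_def minkowski_diff_def by blast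
      moreover have "d - d0 = - (\<rho> *\<^sub>R (adjoint L k - adjoint L k0))"
        unfolding k(2) d0_def by (simp add: algebra_simps)
      ultimately show ?thesis by simp
    qed
    have "(- z0) \<bullet> (d - d') = 0" if "d \<in> D" "d' \<in> D" for d d'
      using to_d0[OF that(1)] to_d0[OF that(2)] by (simp add: inner_diff_right)
    then show ?thesis
      using proj_shift_orthogonal[OF convex_D closed_D nonempty(2), of "- z0" x] by simp
  qed
  show ?thesis
    unfolding sum D_def[symmetric]
    using convex closed_sum formula primal_shift dual_shift by simp
qed

end
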